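(* Let $h: J\to[0,\infty)$ and $f:I\to(0,\infty)$. (i) If $h$ is superadditive and $f$ is $\mathrm{G_tH_h}$-concave, then for all $x,y,z\in I$ $$\frac{1}{f(\sqrt{xz})}+\frac{1}{f(\sqrt{yz})}+\frac{1}{f(\sqrt{xy})}\le h(1/2)\left[\frac{1}{f(x)}+\frac{1}{f(y)}+\frac{1}{f(z)}\right]+\frac{h(3/2)}{f(\sqrt[3]{xyz})}.$$ (ii) If $h$ is subadditive and $f$ is $\mathrm{G_tH_h}$-convex, then the reverse inequality ($\ge$) holds for all $x,y,z\in I$.
   Context: $I\subseteq(0,\infty)$ is an interval. $J$ is a real interval containing $(0,1)$ and the point $3/2$. The function $h:J\to[0,\infty)$ is such that $h(t)$ and $h(1-t)$ are never both zero. $h$ is superadditive (resp. subadditive) if $h(s+t)\ge h(s)+h(t)$ (resp. $\le$) whenever $s,t,s+t\in J$. A function $f:I\to(0,\infty)$ is $\mathrm{G_tH_h}$-convex if $$f(\alpha^t\beta^{1-t})\le \frac{f(\alpha)f(\beta)}{h(1-t)f(\alpha)+h(t)f(\beta)}$$ for all $\alpha,\beta\in I$ and all $t\in[0,1]$ with $t,1-t\in J$; it is $\mathrm{G_tH_h}$-concave if the reverse inequality ($\ge$) holds for all such $\alpha,\beta,t$. *)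

theory Defs
  imports "HOL-Analysis.Analysis"
begin

text \<open>
  Functions on a real interval are total functions constrained only on an explicit
  domain; J is the domain of h and I is the domain of f.
\<close>

definition superadditive_on :: "real set \<Rightarrow> (real \<Rightarrow> real) \<Rightarrow> bool" where
  "superadditive_on J h \<longleftrightarrow>
     (\<forall>s\<in>J. \<forall>t\<in>J. s + t \<in> J \<longrightarrow> h (s + t) \<ge> h s + h t)"

definition subadditive_on :: "real set \<Rightarrow> (real \<Rightarrow> real) \<Rightarrow> bool" where
  "subadditive_on J h \<longleftrightarrow>
     (\<forall>s\<in>J. \<forall>t\<in>J. s + t \<in> J \<longrightarrow> h (s + t) \<le> h s + h t)"

text \<open>
  If 0 or 1 is missing from J, the endpoints t = 0 and t = 1 are not tested.
  The quotient is genuine (nonzero denominator) when f is positive on I and h is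
  nonnegative on J with h t and h (1 - t) never both zero.
\<close>

definition GtHh_convex_on ::
  "real set \<Rightarrow> (real \<Rightarrow> real) \<Rightarrow> real set \<Rightarrow> (real \<Rightarrow> real) \<Rightarrow> bool" where
  "GtHh_convex_on J h I f \<longleftrightarrow>
     (\<forall>\<alpha>\<in>I. \<forall>\<beta>\<in>I. \<forall>t\<in>{0..1}. t \<in> J \<and> 1 - t \<in> J \<longrightarrow>
        f (\<alpha> powr t * \<beta> powr (1 - t))
          \<le> f \<alpha> * f \<beta> / (h (1 - t) * f \<alpha> + h t * f \<beta>))"

definition GtHh_concave_on ::
  "real set \<Rightarrow> (real \<Rightarrow> real) \<Rightarrow> real set \<Rightarrow> (real \<Rightarrow> real) \<Rightarrow> bool" where
  "GtHh_concave_on J h I f \<longleftrightarrow>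
     (\<forall>\<alpha>\<in>I. \<forall>\<beta>\<in>I. \<forall>t\<in>{0..1}. t \<in> J \<and> 1 - t \<in> J \<longrightarrow>
        f (\<alpha> powr t * \<beta> powr (1 - t))
          \<ge> f \<alpha> * f \<beta> / (h (1 - t) * f \<alpha> + h t * f \<beta>))"

end

theory Submission imports Defs
begin

text \<open>
  In the logarithmic variable \<open>u = ln x\<close>, the function \<open>g u = 1 / f (exp u)\<close> turns
  the concavity condition on \<open>f\<close> into ordinary \<open>h\<close>-convexity,
  \<open>g (t a + (1 - t) b) \<le> h t g a + h (1 - t) g b\<close>, and the claim into Popoviciu's inequality
  for \<open>g\<close>: geometric means become midpoints and the centroid \<open>m\<close> of three points.

  For that inequality, suppose first that none of the points equals \<open>m\<close>. Their deviations from
  \<open>m\<close> sum to zero, so one of the points, say \<open>z\<close>, lies on one side of \<open>m\<close> and the other two on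
  the opposite side. Then the midpoints of \<open>x, z\<close> and of \<open>y, z\<close> lie between \<open>m\<close> and \<open>z\<close>, with
  weights \<open>s\<close> and \<open>t\<close> at \<open>m\<close> satisfying \<open>s + t = 3/2\<close>, hence with weights at \<open>z\<close> adding up to
  \<open>1/2\<close>. Convexity at these two midpoints and at that of \<open>x, y\<close>, followed by superadditivity
  \<open>h s + h t \<le> h (3/2)\<close> and \<open>h (1 - s) + h (1 - t) \<le> h (1/2)\<close>, gives the result
  (\<open>popoviciu_separated\<close>).

  If a point equals \<open>m\<close>, one of the weights would be 1, and convexity with the weights 1 and 0 is
  not at hand because 0 need not lie in \<open>J\<close>. What replaces it is \<open>h (3/2) \<ge> 1 + h (1/2)\<close>: convexity at
  two equal points forces \<open>2 h (1/2) \<ge> 1\<close>, and superadditivity does the rest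
  (\<open>popoviciu_centroid\<close>).

  The convex, subadditive half is the same argument with every inequality reversed.
\<close>

section \<open>Popoviciu's inequality for h-convex functions\<close>

text \<open>
  The factor \<open>\<sigma>\<close> treats both halves of the result at once: with \<open>\<sigma> = 1\<close> the function \<open>g\<close> is
  \<open>h\<close>-convex and \<open>h\<close> superadditive, with \<open>\<sigma> = -1\<close> it is \<open>h\<close>-concave and \<open>h\<close> subadditive. The
  weights in \<open>h_convex\<close> stay strictly between 0 and 1, since only these and their complements are
  certain to lie in \<open>J\<close>.
\<close>

locale signed_h_convex =
  fixes K J :: "real set" and g h :: "real \<Rightarrow> real" and \<sigma> :: real
  assumes convex_K: "convex K"
    and g_pos: "u \<in> K \<Longrightarrow> g u > 0"
    and weights: "{0<..1} \<subseteq> J" "3/2 \<in> J"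
    and additive: "\<lbrakk>s \<in> J; t \<in> J; s + t \<in> J\<rbrakk> \<Longrightarrow> \<sigma> * (h s + h t) \<le> \<sigma> * h (s + t)"
    and h_convex: "\<lbrakk>a \<in> K; b \<in> K; 0 < t; t < 1\<rbrakk> \<Longrightarrow>
      \<sigma> * g (t * a + (1 - t) * b) \<le> \<sigma> * (h t * g a + h (1 - t) * g b)"
begin

lemma h_convex_midpoint:
  assumes "a \<in> K" "b \<in> K"
  shows "\<sigma> * g ((a + b) / 2) \<le> \<sigma> * (h (1/2) * (g a + g b))"
  using h_convex[OF assms, of "1/2"] by (simp add: add_divide_distrib distrib_left)

lemma h_three_halves:
  assumes "u \<in> K"
  shows "\<sigma> * (1 + h (1/2)) \<le> \<sigma> * h (3/2)"
proof -
  have J: "1/2 \<in> J" "1 \<in> J"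
    using weights(1) by auto
  have "\<sigma> * g u \<le> (\<sigma> * (2 * h (1/2))) * g u"
    using h_convex_midpoint[OF assms assms] by (simp add: mult_ac)
  hence "\<sigma> \<le> \<sigma> * (2 * h (1/2))"
    using g_pos[OF assms] by (simp add: mult_le_cancel_right)
  also have "\<dots> \<le> \<sigma> * h 1"
    using additive[of "1/2" "1/2"] J by simp
  finally have "\<sigma> \<le> \<sigma> * h 1" .
  moreover have "\<sigma> * (h 1 + h (1/2)) \<le> \<sigma> * h (3/2)"
    using additive[of 1 "1/2"] J weights(2) by simp
  ultimately show ?thesis by (simp add: algebra_simps)
qed

lemma popoviciu_centroid:
  assumes "x \<in> K" "y \<in> K" "z \<in> K" and centroid: "x + z = 2 * y"
  shows "\<sigma> * (g ((x + z) / 2) + g ((y + z) / 2) + g ((x + y) / 2))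
       \<le> \<sigma> * (h (1/2) * (g x + g y + g z) + h (3/2) * g ((x + y + z) / 3))"
proof -
  have mid: "(x + z) / 2 = y" "(x + y + z) / 3 = y"
    using centroid by auto
  have "\<sigma> * (1 + h (1/2)) * g y \<le> \<sigma> * h (3/2) * g y"
    using h_three_halves[OF assms(2)] g_pos[OF assms(2)] by (intro mult_right_mono) auto
  moreover note h_convex_midpoint[OF assms(1,2)] h_convex_midpoint[OF assms(2,3)]
  ultimately show ?thesis
    unfolding mid by (simp add: algebra_simps)
qed

text \<open>
  The two hypotheses on signs say that \<open>m\<close> strictly separates \<open>z\<close> from both \<open>x\<close> and \<open>y\<close>; they do
  not fix the side on which \<open>z\<close> lies, so that no ordering of the points is needed.
\<close>

lemma popoviciu_separated:
  fixes x y z :: real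
  defines "m \<equiv> (x + y + z) / 3"
  assumes "x \<in> K" "y \<in> K" "z \<in> K"
    and opp: "(x - m) * (z - m) < 0" "(y - m) * (z - m) < 0"
  shows "\<sigma> * (g ((x + z) / 2) + g ((y + z) / 2) + g ((x + y) / 2))
       \<le> \<sigma> * (h (1/2) * (g x + g y + g z) + h (3/2) * g m)"
proof -
  have K_m: "m \<in> K"
  proof -
    have "(2/3) *\<^sub>R ((1/2) *\<^sub>R x + (1/2) *\<^sub>R y) + (1/3) *\<^sub>R z \<in> K"
      using assms(2-4) by (intro convexD[OF convex_K]) auto
    also have "(2/3) *\<^sub>R ((1/2) *\<^sub>R x + (1/2) *\<^sub>R y) + (1/3) *\<^sub>R z = m"
      by (simp add: m_def field_simps)
    finally show ?thesis .
  qed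
  have ne: "m - z \<noteq> 0" using opp by auto
  \<comment> \<open>The deviations of \<open>x\<close> and \<open>y\<close> from \<open>m\<close>, as fractions of their total \<open>m - z\<close>.\<close>
  define p q where "p = (x - m) / (m - z)" and "q = (y - m) / (m - z)"
  have pq: "p > 0" "q > 0"
    using opp by (auto simp: p_def q_def zero_less_divide_iff mult_less_0_iff)
  have "x - m + (y - m) = m - z" by (simp add: m_def field_simps)
  hence sum: "p + q = 1"
    using ne unfolding p_def q_def by (metis add_divide_distrib divide_self)
  have xy: "x = m + p * (m - z)" "y = m + q * (m - z)"
    using ne by (auto simp: p_def q_def)
  define s t where "s = 1/2 + p/2" and "t = 1/2 + q/2"
  have st: "0 < s" "s < 1" "0 < t" "t < 1"
    using pq sum unfolding s_def t_def by auto
  have st_sum: "s + t = 3/2"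
    using sum unfolding s_def t_def by linarith
  hence st_compl: "(1 - s) + (1 - t) = 1/2"
    by linarith
  have eq: "(x + z) / 2 = s * m + (1 - s) * z" "(y + z) / 2 = t * m + (1 - t) * z"
    unfolding xy s_def t_def by (simp_all add: field_simps)
  have J: "s \<in> J" "t \<in> J" "1 - s \<in> J" "1 - t \<in> J" "1/2 \<in> J"
    using st weights(1) by auto
  have "\<sigma> * (h s + h t) * g m \<le> \<sigma> * h (3/2) * g m"
    using additive[of s t] J st_sum weights(2) g_pos[OF K_m] by (intro mult_right_mono) auto
  moreover have "\<sigma> * (h (1 - s) + h (1 - t)) * g z \<le> \<sigma> * h (1/2) * g z"
    using additive[of "1 - s" "1 - t"] J(3,4,5) g_pos[OF assms(4)] unfolding st_compl
    by (intro mult_right_mono) auto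
  moreover note h_convex[OF K_m assms(4) st(1,2)] h_convex[OF K_m assms(4) st(3,4)]
    h_convex_midpoint[OF assms(2,3)]
  ultimately show ?thesis
    unfolding eq by (simp add: algebra_simps)
qed

text \<open>
  The claim is symmetric in the three points, so it only remains to see that, after relabelling,
  one of the two special cases applies: three numbers with sum zero either include a zero or
  contain exactly one whose sign is opposite to that of the other two.
\<close>

theorem popoviciu:
  assumes K: "x \<in> K" "y \<in> K" "z \<in> K"
  shows "\<sigma> * (g ((x + z) / 2) + g ((y + z) / 2) + g ((x + y) / 2))
       \<le> \<sigma> * (h (1/2) * (g x + g y + g z) + h (3/2) * g ((x + y + z) / 3))"
proof -
  define m where "m = (x + y + z) / 3"
  have m: "(x + y + z) / 3 = m" "(y + x + z) / 3 = m" "(x + z + y) / 3 = m" "(y + z + x) / 3 = m"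
    by (simp_all add: m_def algebra_simps)
  have dev: "(x - m) + (y - m) + (z - m) = 0" by (simp add: m_def field_simps)
  consider "x + z = 2 * y" | "y + z = 2 * x" | "x + y = 2 * z"
    | "(x - m) * (z - m) < 0" "(y - m) * (z - m) < 0"
    | "(x - m) * (y - m) < 0" "(z - m) * (y - m) < 0"
    | "(y - m) * (x - m) < 0" "(z - m) * (x - m) < 0"
  proof -
    have "x = m \<or> y = m \<or> z = m
      \<or> (x - m) * (z - m) < 0 \<and> (y - m) * (z - m) < 0
      \<or> (x - m) * (y - m) < 0 \<and> (z - m) * (y - m) < 0
      \<or> (y - m) * (x - m) < 0 \<and> (z - m) * (x - m) < 0"
      unfolding mult_less_0_iff using dev by linarith
    thus ?thesis using that dev by (smt (verit))
  qed
  thus ?thesis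
  proof cases
    case 1
    show ?thesis using popoviciu_centroid[OF K 1] .
  next
    case 2
    show ?thesis using popoviciu_centroid[OF K(2,1,3) 2] by (simp add: add_ac)
  next
    case 3
    show ?thesis using popoviciu_centroid[OF K(1,3,2) 3] by (simp add: add_ac)
  next
    case 4
    show ?thesis using popoviciu_separated[OF K] 4 unfolding m by blast
  next
    case 5
    show ?thesis using popoviciu_separated[OF K(1,3,2)] 5 unfolding m by (simp add: add_ac)
  next
    case 6
    show ?thesis using popoviciu_separated[OF K(2,3,1)] 6 unfolding m by (simp add: add_ac)
  qed
qed

end

section \<open>Passage to logarithmic variables\<close>

lemma convex_vimage_exp:
  fixes I :: "real set"
  assumes "is_interval I"
  shows "convex {u. exp u \<in> I}"
proof -
  have "is_interval {u. exp u \<in> I}"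
    unfolding is_interval_1 using mem_is_interval_1_I[OF assms]
    by (metis exp_le_cancel_iff mem_Collect_eq)
  thus ?thesis by (simp add: is_interval_convex)
qed

lemma exp_mean_ln2:
  fixes x y :: real
  assumes "x > 0" "y > 0"
  shows "exp ((ln x + ln y) / 2) = sqrt (x * y)"
proof -
  have "exp ((ln x + ln y) / 2) ^ 2 = exp (ln x + ln y)"
    unfolding exp_of_nat_mult[symmetric] by simp
  hence "exp ((ln x + ln y) / 2) ^ 2 = x * y"
    using assms by (simp add: exp_add)
  thus ?thesis
    by (metis exp_ge_zero real_sqrt_unique)
qed

lemma exp_mean_ln3:
  fixes x y z :: real
  assumes "x > 0" "y > 0" "z > 0"
  shows "exp ((ln x + ln y + ln z) / 3) = root 3 (x * y * z)"
proof -
  have "exp ((ln x + ln y + ln z) / 3) ^ 3 = exp (ln x + ln y + ln z)"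
    unfolding exp_of_nat_mult[symmetric] by simp
  hence "exp ((ln x + ln y + ln z) / 3) ^ 3 = x * y * z"
    using assms by (simp add: exp_add)
  thus ?thesis
    by (metis exp_ge_zero real_root_pos_unique zero_less_numeral)
qed

text \<open>
  The weighted harmonic mean is the reciprocal of \<open>p / A + q / B\<close>; positivity
  of its denominator is what makes taking reciprocals reverse the inequality.
\<close>

lemma weighted_harmonic_mean_iff:
  fixes A B C p q :: real
  assumes "A > 0" "B > 0" "C > 0" "p \<ge> 0" "q \<ge> 0" "\<not> (p = 0 \<and> q = 0)"
  shows "A * B / (q * A + p * B) \<le> C \<longleftrightarrow> 1 / C \<le> p * (1 / A) + q * (1 / B)"
    and "C \<le> A * B / (q * A + p * B) \<longleftrightarrow> p * (1 / A) + q * (1 / B) \<le> 1 / C"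
proof -
  have D: "q * A + p * B > 0"
    using assms by (metis add_nonneg_pos add_pos_nonneg less_eq_real_def mult_nonneg_nonneg mult_pos_pos)
  have eq: "p * (1 / A) + q * (1 / B) = (q * A + p * B) / (A * B)"
    using assms by (simp add: field_simps)
  show "A * B / (q * A + p * B) \<le> C \<longleftrightarrow> 1 / C \<le> p * (1 / A) + q * (1 / B)"
    unfolding eq using assms D by (simp add: divide_le_eq le_divide_eq mult_ac)
  show "C \<le> A * B / (q * A + p * B) \<longleftrightarrow> p * (1 / A) + q * (1 / B) \<le> 1 / C"
    unfolding eq using assms D by (simp add: divide_le_eq le_divide_eq mult_ac)
qed

theorem theorem7:
  fixes I J :: "real set" and f h :: "real \<Rightarrow> real"
  assumes I_interval: "is_interval I" and I_pos: "I \<subseteq> {0<..}"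
    and J_interval: "is_interval J" and J_contains: "{0<..<1} \<subseteq> J" "3/2 \<in> J"
    and h_nonneg: "\<And>t. t \<in> J \<Longrightarrow> h t \<ge> 0"
    and h_not_both_zero: "\<And>t. t \<in> J \<Longrightarrow> 1 - t \<in> J \<Longrightarrow> \<not> (h t = 0 \<and> h (1 - t) = 0)"
    and f_pos: "\<And>x. x \<in> I \<Longrightarrow> f x > 0"
  shows "(superadditive_on J h \<and> GtHh_concave_on J h I f \<longrightarrow>
           (\<forall>x\<in>I. \<forall>y\<in>I. \<forall>z\<in>I.
              1 / f (sqrt (x * z)) + 1 / f (sqrt (y * z)) + 1 / f (sqrt (x * y))
                \<le> h (1/2) * (1 / f x + 1 / f y + 1 / f z) + h (3/2) / f (root 3 (x * y * z))))
       \<and> (subadditive_on J h \<and> GtHh_convex_on J h I f \<longrightarrow>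
           (\<forall>x\<in>I. \<forall>y\<in>I. \<forall>z\<in>I.
              1 / f (sqrt (x * z)) + 1 / f (sqrt (y * z)) + 1 / f (sqrt (x * y))
                \<ge> h (1/2) * (1 / f x + 1 / f y + 1 / f z) + h (3/2) / f (root 3 (x * y * z))))"
proof -
  define K where "K = {u. exp u \<in> I}"
  define g where "g u = 1 / f (exp u)" for u
  have convex_K: "convex K"
    unfolding K_def by (rule convex_vimage_exp[OF I_interval])
  have g_pos: "g u > 0" if "u \<in> K" for u
    using that f_pos by (simp add: K_def g_def)
  have "1/2 \<in> J"
    using J_contains(1) by auto
  hence "1 \<in> J"
    using mem_is_interval_1_I[OF J_interval, of "1/2" "3/2" 1] J_contains(2) by simp
  hence weights: "{0<..1} \<subseteq> J"
    using J_contains(1) by (auto simp: less_le)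
  have exp_comb: "exp (t * a + (1 - t) * b) = exp a powr t * exp b powr (1 - t)" for a b t :: real
    by (simp add: exp_add powr_def)
  have in_J: "t \<in> J" "1 - t \<in> J" "t \<in> {0..1}" if "0 < t" "t < 1" for t
    using that J_contains(1) by auto
  have K_comb: "t * a + (1 - t) * b \<in> K" if "a \<in> K" "b \<in> K" "0 < t" "t < 1" for a b t
    using convexD[OF convex_K that(1,2), of t "1 - t"] that(3,4) by simp
  have recip: "f (exp a) * f (exp b) / (h (1 - t) * f (exp a) + h t * f (exp b))
        \<le> f (exp a powr t * exp b powr (1 - t))
      \<longleftrightarrow> g (t * a + (1 - t) * b) \<le> h t * g a + h (1 - t) * g b"
    "f (exp a powr t * exp b powr (1 - t))
        \<le> f (exp a) * f (exp b) / (h (1 - t) * f (exp a) + h t * f (exp b))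
      \<longleftrightarrow> h t * g a + h (1 - t) * g b \<le> g (t * a + (1 - t) * b)"
    if ab: "a \<in> K" "b \<in> K" and t: "0 < t" "t < 1" for a b t
    unfolding g_def exp_comb[symmetric]
    using ab K_comb[OF ab t] in_J[OF t] f_pos h_nonneg h_not_both_zero
    by (intro weighted_harmonic_mean_iff; auto simp: K_def)+
  have ln_K: "ln x \<in> K" "g (ln x) = 1 / f x" "x > 0" if "x \<in> I" for x
    using that I_pos by (auto simp: K_def g_def)
  have g_mean2: "g ((ln x + ln y) / 2) = 1 / f (sqrt (x * y))"
    if "x \<in> I" "y \<in> I" for x y
    using exp_mean_ln2[of x y] ln_K(3) that by (simp add: g_def)
  have g_mean3: "g ((ln x + ln y + ln z) / 3) = 1 / f (root 3 (x * y * z))"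
    if "x \<in> I" "y \<in> I" "z \<in> I" for x y z
    using exp_mean_ln3[of x y z] ln_K(3) that by (simp add: g_def)
  show ?thesis
  proof (intro conjI impI ballI)
    fix x y z assume hyp: "superadditive_on J h \<and> GtHh_concave_on J h I f"
      and I: "x \<in> I" "y \<in> I" "z \<in> I"
    interpret signed_h_convex K J g h 1
    proof
      show "1 * g (t * a + (1 - t) * b) \<le> 1 * (h t * g a + h (1 - t) * g b)"
        if "a \<in> K" "b \<in> K" "0 < t" "t < 1" for a b t
        using hyp recip(1)[OF that] that in_J[OF that(3,4)]
        by (auto simp: GtHh_concave_on_def K_def)
    qed (use convex_K g_pos weights J_contains(2) hyp in \<open>auto simp: superadditive_on_def\<close>)
    show "1 / f (sqrt (x * z)) + 1 / f (sqrt (y * z)) + 1 / f (sqrt (x * y))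
        \<le> h (1/2) * (1 / f x + 1 / f y + 1 / f z) + h (3/2) / f (root 3 (x * y * z))"
      using popoviciu[OF I[THEN ln_K(1)]] by (simp add: g_mean2 g_mean3 I ln_K(2))
  next
    fix x y z assume hyp: "subadditive_on J h \<and> GtHh_convex_on J h I f"
      and I: "x \<in> I" "y \<in> I" "z \<in> I"
    interpret signed_h_convex K J g h "-1"
    proof
      show "-1 * (h s + h t) \<le> -1 * h (s + t)" if "s \<in> J" "t \<in> J" "s + t \<in> J" for s t
        using hyp that by (simp add: subadditive_on_def algebra_simps)
      show "-1 * g (t * a + (1 - t) * b) \<le> -1 * (h t * g a + h (1 - t) * g b)"
        if "a \<in> K" "b \<in> K" "0 < t" "t < 1" for a b t
        using hyp recip(2)[OF that] that in_J[OF that(3,4)]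
        by (auto simp: GtHh_convex_on_def K_def)
    qed (use convex_K g_pos weights J_contains(2) in auto)
    show "1 / f (sqrt (x * z)) + 1 / f (sqrt (y * z)) + 1 / f (sqrt (x * y))
        \<ge> h (1/2) * (1 / f x + 1 / f y + 1 / f z) + h (3/2) / f (root 3 (x * y * z))"
      using popoviciu[OF I[THEN ln_K(1)]] by (simp add: g_mean2 g_mean3 I ln_K(2))
  qed
qed

end
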